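(* Let $h,C\in\mathbb R$. For each $r_0>0$, each of the sets $$\mathcal B_\pm(r_0):=\left\{(r,v,\theta,w)\in[0,\infty)\times\mathbb R\times\left[-\tfrac\pi2,\tfrac\pi2\right]\times\mathbb R\ \middle|\ r=r_0,\ \theta=\pm\tfrac\pi2,\ w=0\right\}$$ is an invariant submanifold of the flow of the regularized isosceles Schwarzschild system (given in the context), on which the flow is gradient-like with respect to the coordinate $-v$.
   Context: Parameters: $M,m,A,A_1,B,B_1>0$, $\mu:=\frac{2M+m}{m}$, with the standing assumptions $\mu>1+\frac{A}{4A_1}$, $\mu>1+\frac{B}{16B_1}$, $(\mu-1)^{4/15}(4A_1/A)^{2/3}\ne(16B_1/B)^{2/5}$. Let $$V(\theta)=\left(\tfrac M2\right)^{1/2}\!\left(\tfrac{A}{\cos\theta}+\tfrac{4A_1}{(\cos^2\theta+\mu\sin^2\theta)^{1/2}}\right),\quad W(\theta)=\left(\tfrac M2\right)^{3/2}\!\left(\tfrac{B}{\cos^3\theta}+\tfrac{16B_1}{(\cos^2\theta+\mu\sin^2\theta)^{3/2}}\right),$$ and $U(\theta)=W(\theta)\cos^3\theta$, which extends to a positive analytic function on $[-\pi/2,\pi/2]$. The regularized equations (energy $h$, angular momentum $C$) on $[0,\infty)\times\mathbb R\times[-\pi/2,\pi/2]\times\mathbb R\ni(r,v,\theta,w)$ are $$r'=\tfrac{\cos^3\theta}{\sqrt U}\,rv,\qquad v'=\tfrac{\cos^3\theta}{2\sqrt U}v^2-\sqrt U+r^2(2hr+V)\tfrac{\cos^3\theta}{\sqrt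 U},\qquad \theta'=w,$$ $$w'=\tfrac{\cos^3\theta}{2\sqrt U}vw+\tfrac{\cos^6\theta}{U}r^2V'(\theta)+\tfrac{U'(\theta)}{U}\left(\cos^3\theta-\tfrac{w^2}{2}\right)-3\sin\theta\cos^2\theta+\tfrac{3\sin\theta\cos^5\theta}{U}\left(v^2-2hr^3-2r^2V\right)+\tfrac{2C^2r\sin\theta\cos^3\theta}{U},$$ (expressions such as $V\cos^3\theta$, $V'\cos^6\theta$ being extended continuously to $\theta=\pm\pi/2$), considered on the energy level $$2hr^3\cos^6\theta=Uw^2+(v^2\cos^3\theta-2U)\cos^3\theta+(C^2-2rV\cos^2\theta)\,r\cos^4\theta .$$ A flow is gradient-like with respect to a function $f$ if $f$ increases along all non-equilibrium orbits. *)

theory Defs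
  imports "HOL-Analysis.Analysis"
begin

section \<open>Smooth submanifolds of a Euclidean space\<close>

primrec Ck_on :: "nat \<Rightarrow> ('a::euclidean_space \<Rightarrow> 'b::euclidean_space) \<Rightarrow> 'a set \<Rightarrow> bool" where
  "Ck_on 0 f S \<longleftrightarrow> continuous_on S f"
| "Ck_on (Suc k) f S \<longleftrightarrow>
     (\<forall>x\<in>S. f differentiable (at x)) \<and>
     (\<forall>d. Ck_on k (\<lambda>x. frechet_derivative f (at x) d) S)"

definition smooth_on :: "'a set \<Rightarrow> ('a::euclidean_space \<Rightarrow> 'b::euclidean_space) \<Rightarrow> bool" where
  "smooth_on S f \<longleftrightarrow> (\<forall>k. Ck_on k f S)"

definition diffeomorphism ::
    "'a set \<Rightarrow> 'b set \<Rightarrow> ('a::euclidean_space \<Rightarrow> 'b::euclidean_space) \<Rightarrow> ('b \<Rightarrow> 'a) \<Rightarrow> bool" where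
  "diffeomorphism N N' \<phi> \<psi> \<longleftrightarrow> homeomorphism N N' \<phi> \<psi> \<and> smooth_on N \<phi> \<and> smooth_on N' \<psi>"

text \<open>Embedded submanifolds (without boundary), described by slice charts of the ambient space.\<close>

definition submanifold :: "'a::euclidean_space set \<Rightarrow> bool" where
  "submanifold S \<longleftrightarrow>
     (\<exists>k. \<forall>p\<in>S. \<exists>N N' \<phi> \<psi> L.
        open N \<and> p \<in> N \<and> open (N' :: 'a set) \<and> diffeomorphism N N' \<phi> \<psi> \<and>
        subspace L \<and> dim L = k \<and> \<phi> ` (N \<inter> S) = N' \<inter> L)"


section \<open>Flow of an autonomous equation on a subset of its phase space\<close>

text \<open>Orbits are parametrised by arbitrary intervals, and derivatives are taken within the interval
  (so one-sided at an end point).\<close>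

definition solution :: "('a::real_normed_vector \<Rightarrow> 'a) \<Rightarrow> 'a set \<Rightarrow> real set \<Rightarrow> (real \<Rightarrow> 'a) \<Rightarrow> bool" where
  "solution F X I x \<longleftrightarrow>
     is_interval I \<and> (\<forall>t\<in>I. x t \<in> X \<and> (x has_vector_derivative F (x t)) (at t within I))"

text \<open>The second condition says that the flow is defined near time 0 at every point of \<open>S\<close>, so that the
  third one is not vacuous.\<close>

definition invariant_set :: "('a::real_normed_vector \<Rightarrow> 'a) \<Rightarrow> 'a set \<Rightarrow> 'a set \<Rightarrow> bool" where
  "invariant_set F X S \<longleftrightarrow>
     S \<subseteq> X \<and>
     (\<forall>p\<in>S. \<exists>\<epsilon>>0. \<exists>x. solution F X {-\<epsilon><..<\<epsilon>} x \<and> x 0 = p) \<and>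
     (\<forall>I x. solution F X I x \<and> (\<exists>t\<in>I. x t \<in> S) \<longrightarrow> (\<forall>t\<in>I. x t \<in> S))"

definition invariant_submanifold ::
    "('a::euclidean_space \<Rightarrow> 'a) \<Rightarrow> 'a set \<Rightarrow> 'a set \<Rightarrow> bool" where
  "invariant_submanifold F X S \<longleftrightarrow> submanifold S \<and> invariant_set F X S"

definition gradient_like :: "('a::real_normed_vector \<Rightarrow> 'a) \<Rightarrow> 'a set \<Rightarrow> ('a \<Rightarrow> real) \<Rightarrow> bool" where
  "gradient_like F S f \<longleftrightarrow>
     (\<forall>I x. solution F S I x \<and> (\<exists>t\<in>I. F (x t) \<noteq> 0) \<longrightarrow> strict_mono_on I (\<lambda>t. f (x t)))"


section \<open>The regularized isosceles Schwarzschild system\<close>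

definition mu :: "real \<Rightarrow> real \<Rightarrow> real" where
  "mu M m = (2 * M + m) / m"

text \<open>\<open>V\<close> and \<open>W\<close> are meaningful only on the open interval from \<open>- pi / 2\<close> to \<open>pi / 2\<close>.\<close>

definition V :: "real \<Rightarrow> real \<Rightarrow> real \<Rightarrow> real \<Rightarrow> real \<Rightarrow> real" where
  "V M m A A1 \<theta> = (M / 2) powr (1/2) *
     (A / cos \<theta> + 4 * A1 / (cos \<theta> ^ 2 + mu M m * sin \<theta> ^ 2) powr (1/2))"

definition W :: "real \<Rightarrow> real \<Rightarrow> real \<Rightarrow> real \<Rightarrow> real \<Rightarrow> real" where
  "W M m B B1 \<theta> = (M / 2) powr (3/2) *
     (B / cos \<theta> ^ 3 + 16 * B1 / (cos \<theta> ^ 2 + mu M m * sin \<theta> ^ 2) powr (3/2))"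

text \<open>Continuous extension to the closed interval of a function given on the open one.\<close>

definition cont_ext :: "(real \<Rightarrow> real) \<Rightarrow> real \<Rightarrow> real" where
  "cont_ext f \<theta> = Lim (at \<theta> within {- pi / 2 <..< pi / 2}) f"

definition U :: "real \<Rightarrow> real \<Rightarrow> real \<Rightarrow> real \<Rightarrow> real \<Rightarrow> real" where
  "U M m B B1 = cont_ext (\<lambda>\<theta>. W M m B B1 \<theta> * cos \<theta> ^ 3)"

definition U' :: "real \<Rightarrow> real \<Rightarrow> real \<Rightarrow> real \<Rightarrow> real \<Rightarrow> real" where
  "U' M m B B1 \<theta> = vector_derivative (U M m B B1) (at \<theta> within {- pi / 2 .. pi / 2})"

text \<open>Extensions of \<open>V cos\<^sup>k\<close> and \<open>V' cos\<^sup>k\<close>.\<close>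

definition Vcos :: "nat \<Rightarrow> real \<Rightarrow> real \<Rightarrow> real \<Rightarrow> real \<Rightarrow> real \<Rightarrow> real" where
  "Vcos k M m A A1 = cont_ext (\<lambda>\<theta>. V M m A A1 \<theta> * cos \<theta> ^ k)"

definition V'cos :: "nat \<Rightarrow> real \<Rightarrow> real \<Rightarrow> real \<Rightarrow> real \<Rightarrow> real \<Rightarrow> real" where
  "V'cos k M m A A1 = cont_ext (\<lambda>\<theta>. deriv (V M m A A1) \<theta> * cos \<theta> ^ k)"

text \<open>Points of the phase space are quadruples \<open>(r, v, \<theta>, w)\<close>.\<close>

type_synonym point = "real \<times> real \<times> real \<times> real"

definition phase_space :: "point set" where
  "phase_space = {0..} \<times> UNIV \<times> {- pi / 2 .. pi / 2} \<times> UNIV"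

definition field ::
    "real \<Rightarrow> real \<Rightarrow> real \<Rightarrow> real \<Rightarrow> real \<Rightarrow> real \<Rightarrow> real \<Rightarrow> real \<Rightarrow> point \<Rightarrow> point" where
  "field M m A A1 B B1 h C = (\<lambda>(r, v, \<theta>, w).
     let u = U M m B B1 \<theta>; u' = U' M m B B1 \<theta> in
     (cos \<theta> ^ 3 / sqrt u * r * v,
      cos \<theta> ^ 3 / (2 * sqrt u) * v ^ 2 - sqrt u
        + r ^ 2 * (2 * h * r * cos \<theta> ^ 3 + Vcos 3 M m A A1 \<theta>) / sqrt u,
      w,
      cos \<theta> ^ 3 / (2 * sqrt u) * v * w
        + r ^ 2 * V'cos 6 M m A A1 \<theta> / u
        + u' / u * (cos \<theta> ^ 3 - w ^ 2 / 2)
        - 3 * sin \<theta> * cos \<theta> ^ 2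
        + 3 * sin \<theta> / u *
            ((v ^ 2 - 2 * h * r ^ 3) * cos \<theta> ^ 5 - 2 * r ^ 2 * Vcos 5 M m A A1 \<theta>)
        + 2 * C ^ 2 * r * sin \<theta> * cos \<theta> ^ 3 / u))"

definition energy_level ::
    "real \<Rightarrow> real \<Rightarrow> real \<Rightarrow> real \<Rightarrow> real \<Rightarrow> real \<Rightarrow> real \<Rightarrow> real \<Rightarrow> point set" where
  "energy_level M m A A1 B B1 h C = {(r, v, \<theta>, w) \<in> phase_space.
     2 * h * r ^ 3 * cos \<theta> ^ 6 =
       U M m B B1 \<theta> * w ^ 2 + (v ^ 2 * cos \<theta> ^ 3 - 2 * U M m B B1 \<theta>) * cos \<theta> ^ 3
       + (C ^ 2 - 2 * r * Vcos 2 M m A A1 \<theta>) * r * cos \<theta> ^ 4}"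

definition B_plus :: "real \<Rightarrow> point set" where
  "B_plus r0 = {(r, v, \<theta>, w) \<in> phase_space. r = r0 \<and> \<theta> = pi / 2 \<and> w = 0}"

definition B_minus :: "real \<Rightarrow> point set" where
  "B_minus r0 = {(r, v, \<theta>, w) \<in> phase_space. r = r0 \<and> \<theta> = - pi / 2 \<and> w = 0}"

text \<open>The limits defining the extensions exist; their closed forms on the closed interval follow.\<close>

lemma cont_ext_eqI:
  assumes "continuous_on {- pi / 2 .. pi / 2} g"
    and "\<And>t. t \<in> {- pi / 2 <..< pi / 2} \<Longrightarrow> f t = g t"
    and "\<theta> \<in> {- pi / 2 .. pi / 2}"
  shows "cont_ext f \<theta> = g \<theta>"
proof -
  have "(g \<longlongrightarrow> g \<theta>) (at \<theta> within {- pi / 2 .. pi / 2})"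
    using assms(1,3) by (simp add: continuous_on_def)
  then have "(g \<longlongrightarrow> g \<theta>) (at \<theta> within {- pi / 2 <..< pi / 2})"
    by (rule tendsto_within_subset) auto
  then have "(f \<longlongrightarrow> g \<theta>) (at \<theta> within {- pi / 2 <..< pi / 2})"
    by (rule Lim_transform_within[where d = 1]) (use assms(2) in auto)
  moreover have "at \<theta> within {- pi / 2 <..< pi / 2} \<noteq> bot"
  proof -
    have "\<theta> \<in> closure {- pi / 2 <..< pi / 2}"
      using assms(3) pi_gt_zero by (simp add: closure_greaterThanLessThan)
    then have "\<theta> islimpt {- pi / 2 <..< pi / 2}"
      by (metis closure_greaterThanLessThan assms(3) pi_gt_zero islimpt_greaterThanLessThan1
          islimpt_greaterThanLessThan2 interior_limit_point interior_open open_greaterThanLessThan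
          closure_def Un_iff mem_Collect_eq)
    then show ?thesis by (simp add: trivial_limit_within)
  qed
  ultimately show ?thesis
    unfolding cont_ext_def by (rule tendsto_Lim[rotated])
qed

lemma quad_pos:
  assumes "M > 0" "m > 0"
  shows "cos \<theta> ^ 2 + mu M m * sin \<theta> ^ 2 > 0"
proof -
  have "mu M m \<ge> 1" using assms by (simp add: mu_def field_simps)
  then have "mu M m * sin \<theta> ^ 2 \<ge> sin \<theta> ^ 2"
    by (simp add: mult_le_cancel_right1)
  then show ?thesis using sin_cos_squared_add[of \<theta>] by linarith
qed

lemma cos_pos_open: "t \<in> {- pi / 2 <..< pi / 2} \<Longrightarrow> cos t > 0"
  by (auto intro!: cos_gt_zero_pi)

lemma U_closed_form:
  assumes "M > 0" "m > 0" "\<theta> \<in> {- pi / 2 .. pi / 2}"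
  shows "U M m B B1 \<theta> = (M / 2) powr (3/2) *
    (B + 16 * B1 * cos \<theta> ^ 3 / (cos \<theta> ^ 2 + mu M m * sin \<theta> ^ 2) powr (3/2))"
  unfolding U_def
proof (rule cont_ext_eqI)
  show "continuous_on {- pi / 2..pi / 2} (\<lambda>\<theta>. (M / 2) powr (3/2) *
    (B + 16 * B1 * cos \<theta> ^ 3 / (cos \<theta> ^ 2 + mu M m * sin \<theta> ^ 2) powr (3/2)))"
    using quad_pos[OF assms(1,2)] by (intro continuous_intros) (auto simp: less_imp_neq[symmetric])
next
  fix t assume "t \<in> {- pi / 2 <..< pi / 2}"
  from cos_pos_open[OF this]
  show "W M m B B1 t * cos t ^ 3 = (M / 2) powr (3/2) *
    (B + 16 * B1 * cos t ^ 3 / (cos t ^ 2 + mu M m * sin t ^ 2) powr (3/2))"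
    by (simp add: W_def distrib_right mult.assoc)
qed (rule assms(3))

lemma Vcos_closed_form:
  assumes "M > 0" "m > 0" "\<theta> \<in> {- pi / 2 .. pi / 2}"
  shows "Vcos (Suc k) M m A A1 \<theta> = (M / 2) powr (1/2) *
    (A * cos \<theta> ^ k + 4 * A1 * cos \<theta> ^ Suc k / (cos \<theta> ^ 2 + mu M m * sin \<theta> ^ 2) powr (1/2))"
  unfolding Vcos_def
proof (rule cont_ext_eqI)
  show "continuous_on {- pi / 2..pi / 2} (\<lambda>\<theta>. (M / 2) powr (1/2) *
    (A * cos \<theta> ^ k + 4 * A1 * cos \<theta> ^ Suc k / (cos \<theta> ^ 2 + mu M m * sin \<theta> ^ 2) powr (1/2)))"
    using quad_pos[OF assms(1,2)] by (intro continuous_intros) (auto simp: less_imp_neq[symmetric])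
next
  fix t assume "t \<in> {- pi / 2 <..< pi / 2}"
  from cos_pos_open[OF this]
  show "V M m A A1 t * cos t ^ Suc k = (M / 2) powr (1/2) *
    (A * cos t ^ k + 4 * A1 * cos t ^ Suc k / (cos t ^ 2 + mu M m * sin t ^ 2) powr (1/2))"
    by (simp add: V_def distrib_right mult.assoc)
qed (rule assms(3))

lemma V'cos_closed_form:
  assumes "M > 0" "m > 0" "\<theta> \<in> {- pi / 2 .. pi / 2}"
  shows "V'cos (k + 2) M m A A1 \<theta> = (M / 2) powr (1/2) *
    (A * sin \<theta> - 4 * A1 * (mu M m - 1) * sin \<theta> * cos \<theta> ^ 3 /
        (cos \<theta> ^ 2 + mu M m * sin \<theta> ^ 2) powr (3/2)) * cos \<theta> ^ k"
  unfolding V'cos_def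
proof (rule cont_ext_eqI)
  show "continuous_on {- pi / 2..pi / 2} (\<lambda>\<theta>. (M / 2) powr (1/2) *
    (A * sin \<theta> - 4 * A1 * (mu M m - 1) * sin \<theta> * cos \<theta> ^ 3 /
        (cos \<theta> ^ 2 + mu M m * sin \<theta> ^ 2) powr (3/2)) * cos \<theta> ^ k)"
    using quad_pos[OF assms(1,2)] by (intro continuous_intros) (auto simp: less_imp_neq[symmetric])
next
  fix t assume "t \<in> {- pi / 2 <..< pi / 2}"
  note c = cos_pos_open[OF this]
  note q = quad_pos[OF assms(1,2), of t]
  let ?q = "cos t ^ 2 + mu M m * sin t ^ 2"
  have p: "?q powr (3/2) = ?q powr (1/2) * ?q"
    using q powr_add[of ?q "1/2" 1] by simp
  have p': "(?q powr (1/2)) ^ 2 = ?q"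
    using q by (simp add: powr_half_sqrt)
  have pm: "?q powr (-1/2) = 1 / ?q powr (1/2)"
    using powr_minus_divide[of ?q "1/2"] by simp
  have "((\<lambda>t. (cos t ^ 2 + mu M m * sin t ^ 2) powr (1/2)) has_real_derivative
      (1/2) * ?q powr (-1/2) * (2 * (mu M m - 1) * sin t * cos t)) (at t)"
    using q by (auto intro!: derivative_eq_intros simp: algebra_simps)
  then have "(V M m A A1 has_real_derivative (M / 2) powr (1/2) *
      (A * sin t / cos t ^ 2 - 4 * A1 *
         ((1/2) * ?q powr (-1/2) * (2 * (mu M m - 1) * sin t * cos t)) / (?q powr (1/2)) ^ 2)) (at t)"
    unfolding V_def[abs_def] using q c
    by (auto intro!: derivative_eq_intros simp: power2_eq_square algebra_simps)
  then have d: "deriv (V M m A A1) t = (M / 2) powr (1/2) *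
      (A * sin t / cos t ^ 2 - 4 * A1 *
         ((1/2) * ?q powr (-1/2) * (2 * (mu M m - 1) * sin t * cos t)) / (?q powr (1/2)) ^ 2)"
    by (rule DERIV_imp_deriv)
  have e: "4 * A1 * ((1/2) * ?q powr (-1/2) * (2 * (mu M m - 1) * sin t * cos t)) /
      (?q powr (1/2)) ^ 2 = 4 * A1 * (mu M m - 1) * sin t * cos t / ?q powr (3/2)"
    unfolding p pm p' by simp
  show "deriv (V M m A A1) t * cos t ^ (k + 2) = (M / 2) powr (1/2) *
    (A * sin t - 4 * A1 * (mu M m - 1) * sin t * cos t ^ 3 / ?q powr (3/2)) * cos t ^ k"
    unfolding d e using c
    by (simp add: field_simps power2_eq_square power3_eq_cube)
qed (rule assms(3))

lemma U_pos:
  assumes "M > 0" "m > 0" "B > 0" "B1 > 0" "\<theta> \<in> {- pi / 2 .. pi / 2}"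
  shows "U M m B B1 \<theta> > 0"
proof -
  have "cos \<theta> \<ge> 0" using assms(5) by (auto intro!: cos_ge_zero)
  then show ?thesis
    using assms by (auto simp: U_closed_form intro!: mult_pos_pos add_pos_nonneg)
qed

end

theory Submission
  imports Defs
begin

text \<open>
  On \<open>cos \<theta> = 0\<close>, \<open>w = 0\<close> every term of the field except \<open>- sqrt U\<close> carries a factor \<open>cos \<theta>\<close> or
  \<open>w\<close>, so the field is the constant vector \<open>(0, - sqrt U, 0, 0)\<close> with \<open>U > 0\<close>. Each of the two sets
  is therefore an affine line along which \<open>v\<close> decreases at constant speed
  (\<open>field_at_binary_collision\<close>); this gives the submanifold (\<open>submanifold_affine\<close>), the local
  orbits and the strict growth of \<open>- v\<close>.

  The remaining point is that no other orbit of the energy level meets such a line. The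
  energy relation makes this a scalar problem: it can be solved for \<open>w\<^sup>2 = g(r, v, \<theta>) cos\<^sup>2 \<theta>\<close> with \<open>g\<close>
  continuous (\<open>energy_relation_solved\<close>). Along an orbit over a compact time interval \<open>g\<close> is bounded,
  hence \<open>\<bar>(cos \<theta>)'\<bar> = \<bar>w sin \<theta>\<bar> \<le> L \<bar>cos \<theta>\<bar>\<close>, and by Gronwall's inequality
  (\<open>gronwall_zero\<close>) \<open>cos \<theta>\<close> vanishes identically if it vanishes once. Then \<open>w = 0\<close>, so \<open>\<theta>' = 0\<close>
  and \<open>r' = 0\<close>: the orbit stays on its line.
\<close>

section \<open>Affine subspaces are submanifolds\<close>

lemma Ck_on_const: "Ck_on k (\<lambda>x. c) S"
  by (induction k arbitrary: c) (simp_all add: frechet_derivative_const)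

lemma Ck_on_translation: "Ck_on k (\<lambda>x. x + a) S"
proof (cases k)
  case (Suc n)
  have D: "((\<lambda>x. x + a) has_derivative (\<lambda>d. d)) (at x)" for x
    by (auto intro!: derivative_eq_intros)
  have "frechet_derivative (\<lambda>x. x + a) (at x) = (\<lambda>d. d)" for x
    using frechet_derivative_at[OF D] by metis
  then show ?thesis
    using D by (auto simp: Suc Ck_on_const differentiable_def)
qed (auto intro!: continuous_intros)

text \<open>The translation moving the affine subspace to its direction is one global slice chart.\<close>

lemma submanifold_affine:
  fixes a :: "'a::euclidean_space"
  assumes "subspace L"
  shows "submanifold ((+) a ` L)"
proof -
  have "diffeomorphism UNIV UNIV (\<lambda>x. x + - a) (\<lambda>x. x + a)"
    unfolding diffeomorphism_def smooth_on_def
    by (intro conjI allI Ck_on_translation homeomorphismI continuous_intros) auto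
  moreover have "(\<lambda>x. x + - a) ` (UNIV \<inter> (+) a ` L) = UNIV \<inter> L"
    by (auto simp: image_iff)
  ultimately show ?thesis
    unfolding submanifold_def using assms
    by (intro exI[of _ "dim L"] ballI exI[of _ UNIV] exI[of _ "\<lambda>x. x + - a"]
        exI[of _ "\<lambda>x. x + a"] exI[of _ L]) auto
qed

section \<open>A scalar Gronwall lemma\<close>

text \<open>The weights \<open>exp (- 2 L t)\<close> and \<open>exp (2 L t)\<close> turn \<open>f\<^sup>2\<close> into a nonincreasing and a nondecreasing
  function: the first one propagates the zero to the right, the second one to the left.\<close>

lemma gronwall_zero:
  fixes f f' :: "real \<Rightarrow> real"
  assumes D: "\<And>t. t \<in> {a..b} \<Longrightarrow> (f has_real_derivative f' t) (at t within {a..b})"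
    and bound: "\<And>t. t \<in> {a..b} \<Longrightarrow> \<bar>f' t\<bar> \<le> L * \<bar>f t\<bar>"
    and zero: "f c = 0" "c \<in> {a..b}" and t: "t \<in> {a..b}"
  shows "f t = 0"
proof -
  have contf: "continuous_on {a..b} f"
    using D by (meson DERIV_continuous continuous_on_eq_continuous_within)
  have DE: "((\<lambda>t. (f t)\<^sup>2 * exp (k * t)) has_real_derivative
      (2 * f t * f' t + k * (f t)\<^sup>2) * exp (k * t)) (at t)" if "t \<in> {a<..<b}" for k t
  proof -
    have "(f has_real_derivative f' t) (at t)"
      using D[of t] that by (simp add: at_within_Icc_at)
    then show ?thesis
      by (auto intro!: derivative_eq_intros simp: algebra_simps power2_eq_square)
  qed
  have est: "\<bar>2 * f t * f' t\<bar> \<le> 2 * L * (f t)\<^sup>2" if "t \<in> {a..b}" for t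
    using mult_left_mono[OF bound[OF that], of "\<bar>f t\<bar>"]
    by (simp add: abs_mult power2_eq_square algebra_simps)
  have "(f t)\<^sup>2 \<le> 0"
  proof (cases "c \<le> t")
    case True
    have "(f t)\<^sup>2 * exp (- 2 * L * t) \<le> (f c)\<^sup>2 * exp (- 2 * L * c)"
    proof (rule DERIV_nonpos_imp_decreasing_open[OF True])
      fix s assume s: "c < s" "s < t"
      then have s': "s \<in> {a<..<b}" using zero t by auto
      have "(2 * f s * f' s + (- 2 * L) * (f s)\<^sup>2) * exp (- 2 * L * s) \<le> 0"
        using est[of s] s' by (auto simp: mult_le_0_iff)
      then show "\<exists>y. ((\<lambda>t. (f t)\<^sup>2 * exp (- 2 * L * t)) has_real_derivative y) (at s) \<and> y \<le> 0"
        using DE[OF s', of "- 2 * L"] by blast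
    qed (use zero t in \<open>auto intro!: continuous_intros continuous_on_subset[OF contf]\<close>)
    then show ?thesis using zero by (simp add: mult_le_0_iff)
  next
    case False
    then have le: "t \<le> c" by simp
    have "(f t)\<^sup>2 * exp (2 * L * t) \<le> (f c)\<^sup>2 * exp (2 * L * c)"
    proof (rule DERIV_nonneg_imp_increasing_open[OF le])
      fix s assume s: "t < s" "s < c"
      then have s': "s \<in> {a<..<b}" using zero t by auto
      have "(2 * f s * f' s + (2 * L) * (f s)\<^sup>2) * exp (2 * L * s) \<ge> 0"
        using est[of s] s' by (auto simp: zero_le_mult_iff)
      then show "\<exists>y. ((\<lambda>t. (f t)\<^sup>2 * exp (2 * L * t)) has_real_derivative y) (at s) \<and> y \<ge> 0"
        using DE[OF s', of "2 * L"] by blast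
    qed (use zero t in \<open>auto intro!: continuous_intros continuous_on_subset[OF contf]\<close>)
    then show ?thesis using zero by (simp add: mult_le_0_iff)
  qed
  then show ?thesis by simp
qed

section \<open>Orbits of the field\<close>

lemma curve_point_components:
  fixes x :: "real \<Rightarrow> point"
  obtains r v \<theta> w where "x = (\<lambda>t. (r t, v t, \<theta> t, w t))"
proof (rule that)
  show "x = (\<lambda>t. (fst (x t), fst (snd (x t)), fst (snd (snd (x t))), snd (snd (snd (x t)))))"
    by simp
qed

lemma solution_point_components:
  fixes r v \<theta> w :: "real \<Rightarrow> real"
  assumes sol: "solution F X I (\<lambda>t. (r t, v t, \<theta> t, w t))" and t: "t \<in> I"
  shows "(r has_real_derivative fst (F (r t, v t, \<theta> t, w t))) (at t within I)"
    and "(v has_real_derivative fst (snd (F (r t, v t, \<theta> t, w t)))) (at t within I)"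
    and "(\<theta> has_real_derivative fst (snd (snd (F (r t, v t, \<theta> t, w t))))) (at t within I)"
proof -
  let ?x = "\<lambda>t. (r t, v t, \<theta> t, w t)"
  have D: "((\<lambda>t. p (?x t)) has_real_derivative p (F (?x t))) (at t within I)"
    if "bounded_linear p" for p
    unfolding has_real_derivative_iff_has_vector_derivative
    using bounded_linear.has_vector_derivative[OF that] assms by (simp add: solution_def)
  show "(r has_real_derivative fst (F (?x t))) (at t within I)"
    "(v has_real_derivative fst (snd (F (?x t)))) (at t within I)"
    "(\<theta> has_real_derivative fst (snd (snd (F (?x t))))) (at t within I)"
    using D[of fst] D[of "\<lambda>p. fst (snd p)"] D[of "\<lambda>p. fst (snd (snd p))"]
    by (simp_all add: bounded_linear_fst bounded_linear_fst_comp bounded_linear_snd_comp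
        bounded_linear_snd)
qed

lemma field_r: "fst (field M m A A1 B B1 h C (r, v, \<theta>, w)) = cos \<theta> ^ 3 / sqrt (U M m B B1 \<theta>) * r * v"
  and field_\<theta>: "fst (snd (snd (field M m A A1 B B1 h C (r, v, \<theta>, w)))) = w"
  by (simp_all add: field_def Let_def)

text \<open>The extensions \<open>V cos\<^sup>3\<close>, \<open>V cos\<^sup>5\<close> and \<open>V' cos\<^sup>6\<close> vanish at the end points, since the poles of \<open>V\<close>
  and \<open>V'\<close> there have only orders 1 and 2. The factor \<open>cos\<^sup>3 \<theta> - w\<^sup>2 / 2\<close> kills the term
  in \<open>U'\<close>.\<close>

lemma field_at_binary_collision:
  assumes "M > 0" "m > 0" "cos s = 0" "s \<in> {- pi / 2 .. pi / 2}"
  shows "field M m A A1 B B1 h C (r, v, s, 0) = (0, - sqrt (U M m B B1 s), 0, 0)"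
proof -
  have "Vcos 3 M m A A1 s = 0" "Vcos 5 M m A A1 s = 0" "V'cos 6 M m A A1 s = 0"
    using Vcos_closed_form[OF assms(1,2,4), of 2] Vcos_closed_form[OF assms(1,2,4), of 4]
      V'cos_closed_form[OF assms(1,2,4), of 4] assms(3)
    by (simp_all add: numeral_eq_Suc)
  then show ?thesis using assms(3) by (simp add: field_def Let_def)
qed

lemma continuous_on_U:
  assumes "M > 0" "m > 0"
  shows "continuous_on {- pi / 2 .. pi / 2} (U M m B B1)"
proof (subst continuous_on_cong[OF refl U_closed_form[OF assms]])
  show "continuous_on {- pi / 2..pi / 2} (\<lambda>\<theta>. (M / 2) powr (3/2) *
    (B + 16 * B1 * cos \<theta> ^ 3 / (cos \<theta> ^ 2 + mu M m * sin \<theta> ^ 2) powr (3/2)))"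
    using quad_pos[OF assms] by (intro continuous_intros) (auto simp: less_imp_neq[symmetric])
qed

lemma continuous_on_Vcos:
  assumes "M > 0" "m > 0"
  shows "continuous_on {- pi / 2 .. pi / 2} (Vcos (Suc k) M m A A1)"
proof (subst continuous_on_cong[OF refl Vcos_closed_form[OF assms]])
  show "continuous_on {- pi / 2..pi / 2} (\<lambda>\<theta>. (M / 2) powr (1/2) *
    (A * cos \<theta> ^ k + 4 * A1 * cos \<theta> ^ Suc k / (cos \<theta> ^ 2 + mu M m * sin \<theta> ^ 2) powr (1/2)))"
    using quad_pos[OF assms] by (intro continuous_intros) (auto simp: less_imp_neq[symmetric])
qed

text \<open>Every term of the energy relation other than \<open>U w\<^sup>2\<close> contains at least \<open>cos\<^sup>3 \<theta>\<close>; factoring out only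
  the square is what a linear differential inequality for \<open>cos \<theta>\<close> needs.\<close>

lemma energy_relation_solved:
  assumes "(r, v, \<theta>, w) \<in> energy_level M m A A1 B B1 h C"
    and "M > 0" "m > 0" "B > 0" "B1 > 0"
  shows "w\<^sup>2 = (2 * h * r ^ 3 * cos \<theta> ^ 4 - v\<^sup>2 * cos \<theta> ^ 4 + 2 * U M m B B1 \<theta> * cos \<theta>
      - (C\<^sup>2 - 2 * r * Vcos 2 M m A A1 \<theta>) * r * (cos \<theta>)\<^sup>2) / U M m B B1 \<theta> * (cos \<theta>)\<^sup>2"
proof -
  have "U M m B B1 \<theta> > 0"
    using assms by (intro U_pos) (auto simp: energy_level_def phase_space_def)
  then have "U M m B B1 \<theta> \<noteq> 0" by simp
  with assms(1) show ?thesis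
    by (simp add: energy_level_def divide_simps) (simp add: algebra_simps eval_nat_numeral)
qed

text \<open>Uniqueness of the orbits on \<open>cos \<theta> = 0\<close> without comparing two solutions of the full
  system: along a compact piece of an orbit in the energy level \<open>\<bar>w\<bar>\<close> is dominated by
  \<open>\<bar>cos \<theta>\<bar>\<close>, so \<open>cos \<theta>\<close> alone satisfies a linear differential inequality. The value \<open>w t0 = 0\<close>
  is itself a consequence of the energy relation.\<close>

lemma orbit_stays_at_binary_collision:
  fixes M m A A1 B B1 h C :: real
  assumes pos: "M > 0" "m > 0" "B > 0" "B1 > 0"
    and sol: "solution (field M m A A1 B B1 h C) (energy_level M m A A1 B B1 h C) I
      (\<lambda>t. (r t, v t, \<theta> t, w t))"
    and t0: "t0 \<in> I" "cos (\<theta> t0) = 0" and t: "t \<in> I"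
  shows "r t = r t0 \<and> \<theta> t = \<theta> t0 \<and> w t = 0"
proof -
  \<comment> \<open>The interval \<open>I\<close> need not be compact; the bound on \<open>g\<close> below is uniform only on compact pieces.\<close>
  define J where "J = {min t0 t..max t0 t}"
  have J: "t0 \<in> J" "t \<in> J" by (auto simp: J_def)
  have JI: "J \<subseteq> I"
  proof
    fix s assume "s \<in> J"
    moreover have "min t0 t \<in> I" "max t0 t \<in> I" using t0 t by (simp_all add: min_def max_def)
    ultimately show "s \<in> I"
      using mem_is_interval_1_I[of I "min t0 t" "max t0 t" s] sol by (simp add: solution_def J_def)
  qed
  have inX: "(r s, v s, \<theta> s, w s) \<in> energy_level M m A A1 B B1 h C" if "s \<in> J" for s
    using sol that JI by (auto simp: solution_def)
  have range: "\<theta> s \<in> {- pi / 2..pi / 2}" if "s \<in> J" for s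
    using inX[OF that] by (auto simp: energy_level_def phase_space_def)
  let ?F = "field M m A A1 B B1 h C"
  have D: "(r has_real_derivative fst (?F (r s, v s, \<theta> s, w s))) (at s within J)"
      "(v has_real_derivative fst (snd (?F (r s, v s, \<theta> s, w s)))) (at s within J)"
      "(\<theta> has_real_derivative fst (snd (snd (?F (r s, v s, \<theta> s, w s))))) (at s within J)"
    if "s \<in> J" for s
    using solution_point_components[OF sol subsetD[OF JI that]] JI
    by (auto intro: DERIV_subset)
  note Dr = D(1)[unfolded field_r] and Dv = D(2) and D\<theta> = D(3)[unfolded field_\<theta>]
  have cont: "continuous_on J r" "continuous_on J v" "continuous_on J \<theta>"
    by (auto simp: continuous_on_eq_continuous_within intro: DERIV_continuous[OF Dr]
        DERIV_continuous[OF Dv] DERIV_continuous[OF D\<theta>])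
  define g where "g s = (2 * h * r s ^ 3 * cos (\<theta> s) ^ 4 - (v s)\<^sup>2 * cos (\<theta> s) ^ 4
      + 2 * U M m B B1 (\<theta> s) * cos (\<theta> s)
      - (C\<^sup>2 - 2 * r s * Vcos 2 M m A A1 (\<theta> s)) * r s * (cos (\<theta> s))\<^sup>2) / U M m B B1 (\<theta> s)" for s
  have contU: "continuous_on J (\<lambda>s. U M m B B1 (\<theta> s))"
    by (rule continuous_on_compose2[OF continuous_on_U[OF pos(1,2)] cont(3)]) (use range in auto)
  have "continuous_on {- pi / 2..pi / 2} (Vcos 2 M m A A1)"
    using continuous_on_Vcos[OF pos(1,2), of 1] by (simp add: numeral_2_eq_2)
  then have contV: "continuous_on J (\<lambda>s. Vcos 2 M m A A1 (\<theta> s))"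
    by (rule continuous_on_compose2[OF _ cont(3)]) (use range in auto)
  have "continuous_on J g"
    unfolding g_def using U_pos[OF pos range]
    by (intro continuous_intros cont contU contV) (auto simp: less_imp_neq[symmetric])
  then have "bounded (g ` J)"
    by (intro compact_imp_bounded compact_continuous_image) (auto simp: J_def)
  then obtain G where G: "\<And>s. s \<in> J \<Longrightarrow> \<bar>g s\<bar> \<le> G"
    by (auto simp: bounded_iff)
  have w_le: "\<bar>w s\<bar> \<le> sqrt G * \<bar>cos (\<theta> s)\<bar>" if "s \<in> J" for s
  proof -
    have "(w s)\<^sup>2 = g s * (cos (\<theta> s))\<^sup>2"
      unfolding g_def by (rule energy_relation_solved[OF inX[OF that] pos])
    also have "\<dots> \<le> G * (cos (\<theta> s))\<^sup>2"
      using G[OF that] by (intro mult_right_mono) auto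
    finally have "sqrt ((w s)\<^sup>2) \<le> sqrt (G * (cos (\<theta> s))\<^sup>2)"
      by (rule real_sqrt_le_mono)
    then show ?thesis by (simp add: real_sqrt_mult)
  qed
  have cos0: "cos (\<theta> s) = 0" if "s \<in> J" for s
  proof (rule gronwall_zero[where f = "\<lambda>s. cos (\<theta> s)" and c = t0])
    fix s assume s: "s \<in> {min t0 t..max t0 t}"
    then have "s \<in> J" by (simp add: J_def)
    show "((\<lambda>s. cos (\<theta> s)) has_real_derivative - sin (\<theta> s) * w s) (at s within {min t0 t..max t0 t})"
      using D\<theta>[OF \<open>s \<in> J\<close>] unfolding J_def by (auto intro!: derivative_eq_intros)
    have "\<bar>- sin (\<theta> s) * w s\<bar> \<le> \<bar>w s\<bar>"
      by (simp add: abs_mult mult_left_le_one_le)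
    then show "\<bar>- sin (\<theta> s) * w s\<bar> \<le> sqrt G * \<bar>cos (\<theta> s)\<bar>"
      using w_le[OF \<open>s \<in> J\<close>] by linarith
  qed (use that t0 in \<open>auto simp: J_def\<close>)
  have w0: "w s = 0" if "s \<in> J" for s
    using w_le[OF that] cos0[OF that] by simp
  have const: "f t = f t0" if "\<And>s. s \<in> J \<Longrightarrow> (f has_real_derivative 0) (at s within J)" for f
  proof -
    have "\<exists>c. \<forall>s\<in>J. f s = c"
      by (rule has_field_derivative_zero_constant) (use that in \<open>auto simp: J_def\<close>)
    then show ?thesis using J by auto
  qed
  show ?thesis
    using const[of r] const[of \<theta>] Dr D\<theta> cos0 w0 J by simp
qed

section \<open>The lines of binary collision\<close>

definition collision_line :: "real \<Rightarrow> real \<Rightarrow> point set" where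
  "collision_line s r0 = {(r, v, \<theta>, w). r = r0 \<and> \<theta> = s \<and> w = 0}"

lemma submanifold_collision_line: "submanifold (collision_line s r0)"
proof -
  let ?L = "{(r, v, \<theta>, w). r = 0 \<and> \<theta> = 0 \<and> w = 0} :: point set"
  have "subspace ?L"
    by (auto simp: subspace_def zero_prod_def)
  moreover have "collision_line s r0 = (+) (r0, 0, s, 0) ` ?L"
    by (auto simp: collision_line_def image_iff zero_prod_def)
  ultimately show ?thesis by (metis submanifold_affine)
qed

context
  fixes M m A A1 B B1 h C s r0 :: real
  assumes pos: "M > 0" "m > 0" "B > 0" "B1 > 0"
    and s: "cos s = 0" "s \<in> {- pi / 2 .. pi / 2}"
begin

lemma invariant_collision_line:
  assumes r0: "r0 \<ge> 0"
  shows "invariant_set (field M m A A1 B B1 h C) (energy_level M m A A1 B B1 h C) (collision_line s r0)"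
  unfolding invariant_set_def
proof (intro conjI ballI allI impI)
  show sub: "collision_line s r0 \<subseteq> energy_level M m A A1 B B1 h C"
    using s r0 by (auto simp: collision_line_def energy_level_def phase_space_def)
  fix p assume "p \<in> collision_line s r0"
  then obtain v0 where p: "p = (r0, v0, s, 0)"
    by (auto simp: collision_line_def)
  let ?x = "\<lambda>t. (r0, v0 - sqrt (U M m B B1 s) * t, s, 0) :: point"
  have "(?x has_vector_derivative (0, - sqrt (U M m B B1 s), 0, 0)) (at t within {-1<..<1})" for t
    by (auto intro!: derivative_eq_intros has_vector_derivative_Pair
        simp: zero_prod_def simp flip: has_real_derivative_iff_has_vector_derivative)
  moreover have "?x t \<in> energy_level M m A A1 B B1 h C" for t
    using sub by (auto simp: collision_line_def)
  ultimately have "solution (field M m A A1 B B1 h C) (energy_level M m A A1 B B1 h C) {-1<..<1} ?x"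
    using field_at_binary_collision[OF pos(1,2) s] by (auto simp: solution_def is_interval_1)
  then show "\<exists>\<epsilon>>0. \<exists>x. solution (field M m A A1 B B1 h C) (energy_level M m A A1 B B1 h C)
      {-\<epsilon><..<\<epsilon>} x \<and> x 0 = p"
    by (intro exI[of _ 1] conjI exI[of _ ?x]) (auto simp: p)
next
  fix I and x :: "real \<Rightarrow> point" and t
  assume *: "solution (field M m A A1 B B1 h C) (energy_level M m A A1 B B1 h C) I x \<and>
    (\<exists>t\<in>I. x t \<in> collision_line s r0)" and t: "t \<in> I"
  obtain r v \<theta> w where x: "x = (\<lambda>t. (r t, v t, \<theta> t, w t))"
    by (rule curve_point_components)
  from * obtain t0 where "t0 \<in> I" "r t0 = r0" "\<theta> t0 = s"
    by (auto simp: x collision_line_def)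
  then show "x t \<in> collision_line s r0"
    using orbit_stays_at_binary_collision[OF pos, of A A1 h C I r v \<theta> w t0 t] * t s
    by (simp add: x collision_line_def)
qed

text \<open>On the line \<open>v\<close> has the constant derivative \<open>- sqrt U\<close>, so \<open>v + sqrt U t\<close> is a constant of motion.\<close>

lemma gradient_like_collision_line:
  "gradient_like (field M m A A1 B B1 h C) (collision_line s r0) (\<lambda>(r, v, \<theta>, w). - v)"
  unfolding gradient_like_def
proof (intro allI impI strict_mono_onI)
  fix I and x :: "real \<Rightarrow> point" and a b
  let ?F = "field M m A A1 B B1 h C" and ?c = "sqrt (U M m B B1 s)"
  assume sol: "solution ?F (collision_line s r0) I x \<and> (\<exists>t\<in>I. ?F (x t) \<noteq> 0)"
    and ab: "a \<in> I" "b \<in> I" "a < b"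
  obtain r v \<theta> w where x: "x = (\<lambda>t. (r t, v t, \<theta> t, w t))"
    by (rule curve_point_components)
  have Dv: "(v has_real_derivative - ?c) (at t within I)" if "t \<in> I" for t
  proof -
    have "\<theta> t = s" "w t = 0"
      using sol that by (auto simp: x solution_def collision_line_def)
    then show ?thesis
      using solution_point_components(2)[OF conjunct1[OF sol[unfolded x]] that]
        field_at_binary_collision[OF pos(1,2) s] by simp
  qed
  have "\<exists>k. \<forall>t\<in>I. v t + ?c * t = k"
  proof (rule has_field_derivative_zero_constant)
    show "convex I" using sol by (simp add: solution_def is_interval_convex)
    show "((\<lambda>t. v t + ?c * t) has_real_derivative 0) (at t within I)" if "t \<in> I" for t
      using Dv[OF that] by (auto intro!: derivative_eq_intros)
  qed
  then have "v a + ?c * a = v b + ?c * b" using ab by metis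
  moreover have "?c * a < ?c * b" using ab U_pos[OF pos s(2)] by simp
  ultimately show "(case x a of (r, v, \<theta>, w) \<Rightarrow> - v) < (case x b of (r, v, \<theta>, w) \<Rightarrow> - v)"
    by (simp add: x)
qed

end

theorem proposition3:
  fixes M m A A1 B B1 h C r0 :: real
  assumes "M > 0" "m > 0" "A > 0" "A1 > 0" "B > 0" "B1 > 0"
    and "mu M m > 1 + A / (4 * A1)"
    and "mu M m > 1 + B / (16 * B1)"
    and "(mu M m - 1) powr (4/15) * (4 * A1 / A) powr (2/3) \<noteq> (16 * B1 / B) powr (2/5)"
    and "r0 > 0"
  shows "\<forall>S \<in> {B_plus r0, B_minus r0}.
           invariant_submanifold (field M m A A1 B B1 h C) (energy_level M m A A1 B B1 h C) S \<and>
           gradient_like (field M m A A1 B B1 h C) S (\<lambda>(r, v, \<theta>, w). - v)"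
proof -
  have lines: "B_plus r0 = collision_line (pi / 2) r0" "B_minus r0 = collision_line (- pi / 2) r0"
    using assms(10)
    by (auto simp: B_plus_def B_minus_def collision_line_def phase_space_def)
      (use pi_gt_zero in linarith)+
  have ends: "cos s = 0" "s \<in> {- pi / 2..pi / 2}" if "s \<in> {pi / 2, - pi / 2}" for s
  proof -
    from that consider "s = pi / 2" | "s = - (pi / 2)" by auto
    then show "cos s = 0" "s \<in> {- pi / 2..pi / 2}" by (cases; hypsubst; simp)+
  qed
  have "invariant_submanifold (field M m A A1 B B1 h C) (energy_level M m A A1 B B1 h C)
        (collision_line s r0) \<and>
      gradient_like (field M m A A1 B B1 h C) (collision_line s r0) (\<lambda>(r, v, \<theta>, w). - v)"
    if "s \<in> {pi / 2, - pi / 2}" for s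
    unfolding invariant_submanifold_def
    using submanifold_collision_line gradient_like_collision_line[OF assms(1,2,5,6) ends[OF that]]
      invariant_collision_line[OF assms(1,2,5,6) ends[OF that] less_imp_le[OF assms(10)]]
    by simp
  then show ?thesis unfolding lines by simp
qed

end
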